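(* Let $M,N\in\mathbb{S}^n$ and suppose that $x^\top Mx\geqslant 0$ for all $x\in\mathbb{R}^{n}$ with $x^\top Nx=0$. Then the following two statements are equivalent: (D3) $\ker N_\perp^\top M N_\perp=\ker N_\perp^\top M^2N_\perp$; (NS3) $\ker N\cap \{\xi\in\mathbb{R}^n\mid \xi^\top M\xi=0\}\subset \ker M$.
   Context: $\mathbb{S}^n$ denotes the set of real symmetric $n\times n$ matrices. For a matrix $A\in\mathbb{R}^{n\times m}$, $\ker A=\{x\in\mathbb{R}^{m}\mid Ax=0\}$, and the annihilator $A_\perp$ denotes any matrix whose columns form a basis of $\ker A$ (a matrix with no columns if $\ker A=\{0\}$); $A_\perp^\top$ is its transpose. Here $N_\perp^\top M N_\perp=(N_\perp)^\top M N_\perp$. The symbol $\subset$ denotes (not necessarily proper) set inclusion. *)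

theory Defs
  imports "Jordan_Normal_Form.Matrix_Kernel"
begin

definition sym_mats :: "nat \<Rightarrow> real mat set" where
  "sym_mats n = {A \<in> carrier_mat n n. A\<^sup>T = A}"

definition quad_form :: "real mat \<Rightarrow> real vec \<Rightarrow> real" where
  "quad_form A x = x \<bullet> (A *\<^sub>v x)"

text \<open>The conjunct \<open>distinct\<close> is needed because \<open>kernel.basis\<close> only sees
  the set of columns. The row condition matters when \<open>P\<close> has no columns,
  which is allowed and happens exactly if the kernel of \<open>A\<close> is trivial.\<close>

definition is_annihilator :: "real mat \<Rightarrow> real mat \<Rightarrow> bool" where
  "is_annihilator A P \<longleftrightarrow>
     dim_row P = dim_col A \<and> distinct (cols P) \<and>
     kernel.basis (dim_col A) A (set (cols P))"

lemma is_annihilator_exists: "\<exists>P. is_annihilator A P"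
proof -
  have A: "A \<in> carrier_mat (dim_row A) (dim_col A)" by simp
  interpret K: kernel "dim_row A" "dim_col A" A by unfold_locales simp
  obtain B where B: "finite B" "K.basis B"
    using kernel_basis_exists[OF A] by blast
  obtain xs where xs: "set xs = B" "distinct xs"
    using finite_distinct_list[OF B(1)] by blast
  have "set xs \<subseteq> carrier_vec (dim_col A)"
    using B(2) mat_kernel_carrier[OF A] unfolding xs(1) K.Ker.basis_def by auto
  then have "cols (mat_of_cols (dim_col A) xs) = xs"
    by (rule cols_mat_of_cols)
  then have "is_annihilator A (mat_of_cols (dim_col A) xs)"
    using B(2) xs unfolding is_annihilator_def by simp
  then show ?thesis ..
qed

end

theory Submission
  imports Defs "Jordan_Normal_Form.DL_Rank"
begin

text \<open>
  The vectors of \<open>ker N\<close> are exactly the vectors \<open>P v\<close>, where \<open>P\<close> is an annihilator of \<open>N\<close>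
  (\<open>annihilator_range\<close>). Such a vector \<open>x\<close> satisfies \<open>x\<^sup>T N x = 0\<close>, so the hypothesis makes \<open>M\<close>
  positive semidefinite on \<open>ker N\<close>; in other words, \<open>P\<^sup>T M P\<close> is positive semidefinite. So is
  \<open>P\<^sup>T M\<^sup>2 P\<close>, whose quadratic form at \<open>v\<close> is the squared length of \<open>M P v\<close>. A symmetric positive
  semidefinite matrix kills every vector on which its quadratic form vanishes
  (\<open>mat_kernel_of_psd\<close>), which determines both kernels:

  \<^item> \<open>v \<in> ker (P\<^sup>T M P)\<close> if and only if \<open>(P v)\<^sup>T M (P v) = 0\<close>;
  \<^item> \<open>v \<in> ker (P\<^sup>T M\<^sup>2 P)\<close> if and only if \<open>M (P v) = 0\<close>.

  Hence the kernels agree if and only if \<open>\<xi>\<^sup>T M \<xi> = 0\<close> and \<open>M \<xi> = 0\<close> are equivalent for every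
  \<open>\<xi> = P v\<close>, that is, for every \<open>\<xi> \<in> ker N\<close>. The implication from right to left is trivial, and the
  other one is the claimed inclusion.
\<close>

lemma scalar_prod_self_eq_0_iff:
  fixes x :: "real vec"
  assumes "x \<in> carrier_vec n"
  shows "x \<bullet> x = 0 \<longleftrightarrow> x = 0\<^sub>v n"
  using conjugate_square_eq_0_vec[OF assms] by simp

lemma quad_form_congruence:
  assumes A: "A \<in> carrier_mat n n" and P: "P \<in> carrier_mat n k" and v: "v \<in> carrier_vec k"
  shows "quad_form (P\<^sup>T * A * P) v = quad_form A (P *\<^sub>v v)"
proof -
  have "(P\<^sup>T * A * P) *\<^sub>v v = P\<^sup>T *\<^sub>v (A *\<^sub>v (P *\<^sub>v v))"
    using A P v by (simp add: assoc_mult_mat_vec[of _ k n _ k] assoc_mult_mat_vec[of _ k n _ n])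
  moreover have "v \<bullet> (P\<^sup>T *\<^sub>v (A *\<^sub>v (P *\<^sub>v v))) = (P *\<^sub>v v) \<bullet> (A *\<^sub>v (P *\<^sub>v v))"
    using transpose_vec_mult_scalar[OF P v, of "A *\<^sub>v (P *\<^sub>v v)"] A P v
    by (metis carrier_vecI comm_scalar_prod dim_mult_mat_vec mult_mat_vec_carrier
        transpose_carrier_mat)
  ultimately show ?thesis by (simp add: quad_form_def)
qed

lemma sym_mats_congruence:
  assumes "A \<in> sym_mats n" and P: "P \<in> carrier_mat n k"
  shows "P\<^sup>T * A * P \<in> sym_mats k"
proof -
  have A: "A \<in> carrier_mat n n" "A\<^sup>T = A" using assms by (auto simp: sym_mats_def)
  have "(P\<^sup>T * A * P)\<^sup>T = P\<^sup>T * (P\<^sup>T * A)\<^sup>T"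
    using A P by (intro transpose_mult) auto
  also have "(P\<^sup>T * A)\<^sup>T = A * P"
    using A P transpose_mult[of "P\<^sup>T" k n A n] by simp
  also have "P\<^sup>T * (A * P) = P\<^sup>T * A * P"
    using A P by (intro assoc_mult_mat[symmetric]) auto
  finally show ?thesis using A P by (simp add: sym_mats_def)
qed

lemma sym_scalar_prod_swap:
  assumes "A \<in> sym_mats n" and x: "x \<in> carrier_vec n" and y: "y \<in> carrier_vec n"
  shows "x \<bullet> (A *\<^sub>v y) = (A *\<^sub>v x) \<bullet> y"
  using transpose_vec_mult_scalar[of A n n y x] assms
  by (auto simp: sym_mats_def intro: comm_scalar_prod)

lemma quad_form_add_smult:
  assumes "A \<in> sym_mats n" and x: "x \<in> carrier_vec n" and y: "y \<in> carrier_vec n"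
  shows "quad_form A (x + t \<cdot>\<^sub>v y)
    = quad_form A x + 2 * t * ((A *\<^sub>v x) \<bullet> y) + t\<^sup>2 * quad_form A y"
proof -
  have A: "A \<in> carrier_mat n n" using assms by (auto simp: sym_mats_def)
  have Ax: "A *\<^sub>v x \<in> carrier_vec n" and Ay: "A *\<^sub>v y \<in> carrier_vec n" using A x y by auto
  have "A *\<^sub>v (x + t \<cdot>\<^sub>v y) = A *\<^sub>v x + t \<cdot>\<^sub>v (A *\<^sub>v y)"
    using A x y by (simp add: mult_add_distrib_mat_vec mult_mat_vec)
  then have "quad_form A (x + t \<cdot>\<^sub>v y)
      = x \<bullet> (A *\<^sub>v x) + t * (x \<bullet> (A *\<^sub>v y)) + (t * (y \<bullet> (A *\<^sub>v x)) + t * (t * (y \<bullet> (A *\<^sub>v y))))"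
    using x y Ax Ay
    by (simp add: quad_form_def add_scalar_prod_distrib[of _ n] scalar_prod_add_distrib[of _ n]
        distrib_left)
  moreover have "y \<bullet> (A *\<^sub>v x) = (A *\<^sub>v x) \<bullet> y" using y Ax by (rule comm_scalar_prod)
  ultimately show ?thesis
    using sym_scalar_prod_swap[OF assms]
    by (simp add: quad_form_def power2_eq_square)
qed

text \<open>
  If the form vanishes at \<open>x\<close>, then \<open>x\<close> minimises it, and so the gradient \<open>2 A x\<close> is zero: otherwise
  a short step from \<open>x\<close> against the gradient would give a negative value.
\<close>

lemma mat_kernel_of_psd:
  assumes A: "A \<in> sym_mats n"
    and psd: "\<And>x. x \<in> carrier_vec n \<Longrightarrow> quad_form A x \<ge> 0"
  shows "mat_kernel A = {x \<in> carrier_vec n. quad_form A x = 0}"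
proof (intro equalityI subsetI)
  fix x assume "x \<in> mat_kernel A"
  then show "x \<in> {x \<in> carrier_vec n. quad_form A x = 0}"
    using A by (auto simp: mat_kernel_def sym_mats_def quad_form_def)
next
  have A': "A \<in> carrier_mat n n" using A by (simp add: sym_mats_def)
  fix x assume "x \<in> {x \<in> carrier_vec n. quad_form A x = 0}"
  then have x: "x \<in> carrier_vec n" and q: "quad_form A x = 0" by auto
  define y where "y = A *\<^sub>v x"
  have y: "y \<in> carrier_vec n" using A' x by (simp add: y_def)
  define a b where "a = y \<bullet> y" and "b = quad_form A y"
  have b: "b \<ge> 0" using psd[OF y] by (simp add: b_def)
  \<comment> \<open>The step \<open>t = - a / (b + 1)\<close> is short enough: \<open>2 a t + b t\<^sup>2\<close> becomes
    \<open>- a\<^sup>2 (b + 2) / (b + 1)\<^sup>2\<close>.\<close>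
  define t where "t = - a / (b + 1)"
  have "0 \<le> quad_form A (x + t \<cdot>\<^sub>v y)" using x y by (intro psd) auto
  also have "\<dots> = 2 * t * a + t\<^sup>2 * b"
    using quad_form_add_smult[OF A x y, of t] q by (simp add: a_def b_def flip: y_def)
  also have "\<dots> = - (t\<^sup>2 * (b + 2))"
  proof -
    have "a = - t * (b + 1)" using b by (simp add: t_def)
    then show ?thesis by (simp only:) (simp add: power2_eq_square algebra_simps)
  qed
  finally have "t\<^sup>2 * (b + 2) \<le> 0" by simp
  then have "t = 0" using b by (simp add: mult_le_0_iff)
  then have "a = 0" using b by (simp add: t_def)
  then have "y = 0\<^sub>v n" using scalar_prod_self_eq_0_iff[OF y] by (simp add: a_def)
  then show "x \<in> mat_kernel A" using x A' by (intro mat_kernelI) (auto simp: y_def)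
qed

text \<open>
  The columns of \<open>P\<close> span the kernel. Linear combinations of a set of vectors have one coefficient
  for each vector, whereas \<open>P *\<^sub>v v\<close> has one for each index; the two agree because the columns are
  distinct.
\<close>

lemma annihilator_range:
  assumes N: "N \<in> carrier_mat m n" and ann: "is_annihilator N P"
  shows "mat_kernel N = (\<lambda>v. P *\<^sub>v v) ` carrier_vec (dim_col P)"
proof -
  interpret K: kernel m n N by unfold_locales (rule N)
  obtain k where k: "dim_col P = k" by simp
  have P: "P \<in> carrier_mat n k" and dist: "distinct (cols P)" and bas: "K.basis (set (cols P))"
    using ann N k by (auto simp: is_annihilator_def)
  have sub: "set (cols P) \<subseteq> mat_kernel N" and gen: "K.span (set (cols P)) = mat_kernel N"
    using bas by (auto simp: K.Ker.basis_def)
  have lincomb: "K.lincomb a (set (cols P)) = P *\<^sub>v vec k (\<lambda>i. a (col P i))" for a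
    using K.NC.mat_mult_eq_lincomb[OF P dist] K.lincomb_same[OF sub] by simp
  have "K.span (set (cols P)) = range (\<lambda>a. K.lincomb a (set (cols P)))"
    using K.Ker.finite_span[OF _ sub] by auto
  also have "\<dots> = (\<lambda>v. P *\<^sub>v v) ` carrier_vec k"
  proof (intro equalityI subsetI)
    fix y assume "y \<in> (\<lambda>v. P *\<^sub>v v) ` carrier_vec k"
    then obtain v where v: "v \<in> carrier_vec k" and y: "y = P *\<^sub>v v" by blast
    have "y = K.lincomb (\<lambda>c. v $ find_first c (cols P)) (set (cols P))"
      unfolding y K.lincomb_same[OF sub] by (rule K.NC.lincomb_eq_mat_mult[OF P v dist, symmetric])
    then show "y \<in> range (\<lambda>a. K.lincomb a (set (cols P)))" by blast
  next
    fix y assume "y \<in> range (\<lambda>a. K.lincomb a (set (cols P)))"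
    then obtain a where "y = P *\<^sub>v vec k (\<lambda>i. a (col P i))" unfolding lincomb by blast
    then show "y \<in> (\<lambda>v. P *\<^sub>v v) ` carrier_vec k" by (rule image_eqI) (rule vec_carrier)
  qed
  finally show ?thesis by (simp only: gen k)
qed

lemma quad_form_square:
  assumes "M \<in> sym_mats n" and x: "x \<in> carrier_vec n"
  shows "quad_form (M ^\<^sub>m 2) x = (M *\<^sub>v x) \<bullet> (M *\<^sub>v x)"
proof -
  have M: "M \<in> carrier_mat n n" using assms by (simp add: sym_mats_def)
  have "M ^\<^sub>m 2 *\<^sub>v x = M *\<^sub>v (M *\<^sub>v x)"
    using M x by (simp add: numeral_2_eq_2 assoc_mult_mat_vec[of _ n n _ n])
  then show ?thesis
    using sym_scalar_prod_swap[OF assms, of "M *\<^sub>v x"] M x by (simp add: quad_form_def)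
qed

lemma sym_mats_square:
  assumes "M \<in> sym_mats n"
  shows "M ^\<^sub>m 2 \<in> sym_mats n"
  using assms transpose_mult[of M n n M n] by (auto simp: sym_mats_def numeral_2_eq_2)

theorem proposition3:
  fixes n :: nat and M N Np :: "real mat"
  assumes "M \<in> sym_mats n" and "N \<in> sym_mats n"
    and "\<And>x. x \<in> carrier_vec n \<Longrightarrow> quad_form N x = 0 \<Longrightarrow> quad_form M x \<ge> 0"
    and "is_annihilator N Np"
  shows "mat_kernel (Np\<^sup>T * M * Np) = mat_kernel (Np\<^sup>T * (M ^\<^sub>m 2) * Np)
    \<longleftrightarrow> mat_kernel N \<inter> {\<xi> \<in> carrier_vec n. quad_form M \<xi> = 0} \<subseteq> mat_kernel M"
proof -
  obtain k where k: "dim_col Np = k" by simp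
  have M: "M \<in> carrier_mat n n" and N: "N \<in> carrier_mat n n"
    using assms(1,2) by (auto simp: sym_mats_def)
  have P: "Np \<in> carrier_mat n k" using assms(4) N k by (auto simp: is_annihilator_def)
  have range: "mat_kernel N = (\<lambda>v. Np *\<^sub>v v) ` carrier_vec k"
    using annihilator_range[OF N assms(4)] by (simp only: k)
  have M2: "M ^\<^sub>m 2 \<in> carrier_mat n n" using M by simp
  have Pv: "Np *\<^sub>v v \<in> carrier_vec n" if "v \<in> carrier_vec k" for v using P that by simp
  have psd: "quad_form M (Np *\<^sub>v v) \<ge> 0" if v: "v \<in> carrier_vec k" for v
  proof (rule assms(3)[OF Pv[OF v]])
    have "Np *\<^sub>v v \<in> mat_kernel N" using v by (simp add: range)
    then show "quad_form N (Np *\<^sub>v v) = 0"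
      using mat_kernelD(2)[OF N] Pv[OF v] by (simp add: quad_form_def)
  qed
  have "mat_kernel (Np\<^sup>T * M * Np) = {v \<in> carrier_vec k. quad_form M (Np *\<^sub>v v) = 0}"
    using mat_kernel_of_psd[OF sym_mats_congruence[OF assms(1) P]] psd
    by (auto simp: quad_form_congruence[OF M P])
  moreover have "mat_kernel (Np\<^sup>T * (M ^\<^sub>m 2) * Np) = {v \<in> carrier_vec k. Np *\<^sub>v v \<in> mat_kernel M}"
  proof -
    have form: "quad_form (Np\<^sup>T * (M ^\<^sub>m 2) * Np) v = (M *\<^sub>v (Np *\<^sub>v v)) \<bullet> (M *\<^sub>v (Np *\<^sub>v v))"
      if "v \<in> carrier_vec k" for v
      using that by (simp add: quad_form_congruence[OF M2 P] quad_form_square[OF assms(1) Pv])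
    have "(M *\<^sub>v (Np *\<^sub>v v)) \<bullet> (M *\<^sub>v (Np *\<^sub>v v)) \<ge> 0" for v
      by (simp add: scalar_prod_def sum_nonneg)
    moreover have "(M *\<^sub>v (Np *\<^sub>v v)) \<bullet> (M *\<^sub>v (Np *\<^sub>v v)) = 0 \<longleftrightarrow> Np *\<^sub>v v \<in> mat_kernel M"
      if "v \<in> carrier_vec k" for v
      using M Pv[OF that] scalar_prod_self_eq_0_iff[of "M *\<^sub>v (Np *\<^sub>v v)" n]
      by (auto simp: mat_kernel[OF M])
    ultimately show ?thesis
      using mat_kernel_of_psd[OF sym_mats_congruence[OF sym_mats_square[OF assms(1)] P]]
      by (auto simp: form)
  qed
  moreover have "quad_form M \<xi> = 0" if "\<xi> \<in> carrier_vec n" "\<xi> \<in> mat_kernel M" for \<xi>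
    using that mat_kernelD(2)[OF M] by (simp add: quad_form_def)
  ultimately show ?thesis using Pv unfolding range by blast
qed

end
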